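(* Let $\alpha$ be an ordinal, let $\lambda$ be a regular cardinal with $\lambda>2^{\aleph_\alpha}$, and let $(X,<)$ be a linearly ordered set with $|X|=\lambda$ satisfying: for every $Y\subseteq X$ with $|Y|=\lambda$ there is $y\in Y$ with $|\{z\in Y: z<y\}|=|\{z\in Y: z>y\}|=\lambda$. Then $X$ contains a subset which is $\lambda$-full in $X$ and whose order type is $\omega_{\alpha+1}$ or the reverse of $\omega_{\alpha+1}$.
   Context: For a linearly ordered set $X$ with $|X|=\lambda$, $Y\subseteq X$ and $y_1<y_2$ in $Y$, write $(y_1,y_2)_X=\{x\in X: y_1<x<y_2\}$. $Y$ is $\lambda$-full in $X$ on the right if for every $y\in Y$, $\left|\bigcup_{y<y'\in Y}(y,y')_X\right|=\lambda$; $Y$ is $\lambda$-full in $X$ on the left if for every $y\in Y$, $\left|\bigcup_{Y\ni y'<y}(y',y)_X\right|=\lambda$. "$\lambda$-full" means $\lambda$-full on the right or on the left. *)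

theory Defs
  imports Main
begin

unbundle cardinal_syntax

text \<open>
  An ordinal is represented by a well-order, and a cardinal by a well-order of minimal length on
  its field (the library's \<^term>\<open>Card_order\<close>), in both cases up to \<^term>\<open>(=o)\<close>.

  A cardinal \<open>\<kappa>\<close> is \<open>\<aleph>\<^sub>\<alpha>\<close> iff it is the \<open>\<alpha>\<close>-th infinite cardinal: it is infinite, and
  the infinite cardinals below it, ordered by \<^term>\<open>(<o)\<close>, are enumerated increasingly by \<open>\<alpha>\<close>.
  Every cardinal below \<open>\<kappa>\<close> has a representative on the type over which \<open>\<kappa>\<close> lives, so it is no
  restriction to let the enumeration range over that type.
  This is a predicate, not a function of \<open>\<alpha>\<close>, since HOL does not provide a type large enough
  to carry \<open>\<aleph>\<^sub>\<alpha>\<close> for every \<open>\<alpha>\<close>.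
\<close>

definition is_aleph :: "'b rel \<Rightarrow> 'c rel \<Rightarrow> bool" where
  "is_aleph \<alpha> \<kappa> \<longleftrightarrow>
     Card_order \<kappa> \<and> infinite (Field \<kappa>) \<and>
     (\<exists>f :: 'b \<Rightarrow> 'c rel.
        (\<forall>a\<in>Field \<alpha>. Card_order (f a) \<and> infinite (Field (f a)) \<and> f a <o \<kappa>) \<and>
        (\<forall>a b. (a, b) \<in> \<alpha> \<and> a \<noteq> b \<longrightarrow> f a <o f b) \<and>
        (\<forall>r :: 'c rel. Card_order r \<and> infinite (Field r) \<and> r <o \<kappa> \<longrightarrow>
           (\<exists>a\<in>Field \<alpha>. r =o f a)))"

lemma is_aleph_zero: "is_aleph {} natLeq"
proof -
  have "\<not> r <o natLeq" if r: "Card_order r" "infinite (Field r)" for r :: "nat rel"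
  proof -
    have "natLeq \<le>o |Field r|"
      using r(2) infinite_iff_natLeq_ordLeq by blast
    then have "natLeq \<le>o r"
      using card_of_Field_ordIso[OF r(1)] ordLeq_ordIso_trans by blast
    then show ?thesis
      using not_ordLess_ordLeq by blast
  qed
  then show ?thesis
    unfolding is_aleph_def using natLeq_Card_order by (auto simp: Field_natLeq)
qed

text \<open>
  The definition is compatible with the usual recursion: \<open>\<aleph>\<^bsub>\<alpha>+1\<^esub>\<close> is the successor cardinal of
  \<open>\<aleph>\<^sub>\<alpha>\<close>. Hence \<open>\<omega>\<^bsub>\<alpha>+1\<^esub>\<close>, the initial ordinal of \<open>\<aleph>\<^bsub>\<alpha>+1\<^esub>\<close>, is represented by \<open>cardSuc \<kappa>\<close>
  whenever \<open>\<kappa>\<close> represents \<open>\<aleph>\<^sub>\<alpha>\<close>.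
\<close>

definition ord_succ :: "'b rel \<Rightarrow> 'b option rel" where
  "ord_succ \<alpha> = map_prod Some Some ` \<alpha> \<union> insert None (Some ` Field \<alpha>) \<times> {None}"

lemma Field_ord_succ: "Field (ord_succ \<alpha>) = insert None (Some ` Field \<alpha>)"
  unfolding ord_succ_def Field_def by (auto simp: image_iff)

lemma is_aleph_succ:
  fixes \<alpha> :: "'b rel" and \<kappa> :: "'c rel"
  assumes "is_aleph \<alpha> \<kappa>"
  shows "is_aleph (ord_succ \<alpha>) (cardSuc \<kappa>)"
proof -
  have co: "Card_order \<kappa>" and inf: "infinite (Field \<kappa>)"
    using assms unfolding is_aleph_def by simp_all
  obtain f :: "'b \<Rightarrow> 'c rel" where f:
    "\<forall>a\<in>Field \<alpha>. Card_order (f a) \<and> infinite (Field (f a)) \<and> f a <o \<kappa>"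
    "\<forall>a b. (a, b) \<in> \<alpha> \<and> a \<noteq> b \<longrightarrow> f a <o f b"
    "\<forall>r :: 'c rel. Card_order r \<and> infinite (Field r) \<and> r <o \<kappa> \<longrightarrow> (\<exists>a\<in>Field \<alpha>. r =o f a)"
    using assms unfolding is_aleph_def by (elim conjE exE)
  note f1 = f(1)[rule_format] and f2 = f(2)[rule_format, OF conjI] and
    f3 = f(3)[rule_format, OF conjI, OF _ conjI]
  define T :: "'c rel \<Rightarrow> 'c set rel" where "T r = |(\<lambda>x. {x}) ` Field r|" for r
  define g where "g x = T (case x of None \<Rightarrow> \<kappa> | Some a \<Rightarrow> f a)" for x
  have T: "T r =o r" if "Card_order r" for r
  proof -
    have "|Field r| =o T r"
      unfolding T_def by (rule card_of_ordIsoI) (auto intro: inj_on_imp_bij_betw)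
    then show ?thesis
      by (rule ordIso_transitive[OF ordIso_symmetric card_of_Field_ordIso[OF that]])
  qed
  have Tc: "Card_order (T r)" for r
    unfolding T_def by (rule card_of_Card_order)
  have Ti: "infinite (Field (T r))" if "infinite (Field r)" for r
    using that unfolding T_def by (auto simp: Field_card_of dest: finite_imageD)
  have Tl: "T r <o T s" if "Card_order r" "Card_order s" "r <o s" for r s
    by (rule ordIso_ordLess_trans[OF T[OF that(1)]
          ordLess_ordIso_trans[OF that(3) ordIso_symmetric[OF T[OF that(2)]]]])
  have suc: "\<kappa> <o cardSuc \<kappa>"
    using co by (rule cardSuc_greater)
  have cs: "Card_order (cardSuc \<kappa>)"
    using co by (rule cardSuc_Card_order)
  have "infinite (Field (cardSuc \<kappa>))"
    using cardSuc_finite[OF co] inf by simp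
  moreover have "Card_order (g x) \<and> infinite (Field (g x)) \<and> g x <o cardSuc \<kappa>"
    if x: "x \<in> Field (ord_succ \<alpha>)" for x
  proof (cases x)
    case None
    then show ?thesis
      using Tc Ti inf ordIso_ordLess_trans[OF T[OF co] suc] by (simp add: g_def)
  next
    case (Some a)
    then have a: "a \<in> Field \<alpha>"
      using x by (auto simp: Field_ord_succ)
    have "T (f a) <o cardSuc \<kappa>"
      using f1[OF a] by (blast intro: ordIso_ordLess_trans[OF T] ordLess_transitive[OF _ suc])
    then show ?thesis
      using Some Tc Ti f1[OF a] by (simp add: g_def)
  qed
  moreover have "g x <o g y" if xy: "(x, y) \<in> ord_succ \<alpha>" "x \<noteq> y" for x y
  proof -
    consider a b where "x = Some a" "y = Some b" "(a, b) \<in> \<alpha>" "a \<noteq> b"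
      | a where "x = Some a" "y = None" "a \<in> Field \<alpha>"
      using xy unfolding ord_succ_def by auto
    then show ?thesis
    proof cases
      case 1
      then have "a \<in> Field \<alpha>" "b \<in> Field \<alpha>"
        by (auto simp: Field_def)
      then show ?thesis
        using 1 f1 f2 Tl by (simp add: g_def)
    next
      case 2
      then show ?thesis
        using f1 co Tl by (simp add: g_def)
    qed
  qed
  moreover have "\<exists>x\<in>Field (ord_succ \<alpha>). r =o g x"
    if r: "Card_order r" "infinite (Field r)" "r <o cardSuc \<kappa>" for r :: "'c set rel"
  proof -
    have le: "r \<le>o \<kappa>"
      using r(1,3) co cardSuc_ordLess_ordLeq not_ordLess_ordLeq
        cardSuc_ordLeq_ordLess by blast
    show ?thesis
    proof (cases "r =o \<kappa>")
      case True
      then have "r =o g None"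
        using ordIso_transitive[OF _ ordIso_symmetric[OF T[OF co]]] by (simp add: g_def)
      then show ?thesis
        by (auto simp: Field_ord_succ)
    next
      case False
      then have lt: "r <o \<kappa>"
        using le ordLeq_iff_ordLess_or_ordIso by blast
      obtain q :: "'c rel" where q: "r =o q" "q <o \<kappa>"
        using iffD1[OF internalize_ordLess lt] by blast
      have qc: "Card_order q"
        using r(1) q(1) Card_order_ordIso2 by blast
      have qi: "infinite (Field q)"
        using card_of_ordIso_finite_Field[OF r(1)
            ordIso_transitive[OF q(1) ordIso_symmetric[OF card_of_Field_ordIso[OF qc]]]] r(2)
        by simp
      obtain a where a: "a \<in> Field \<alpha>" "q =o f a"
        using f3[OF qc qi q(2)] by blast
      have "r =o T (f a)"
        using f1[OF a(1)] ordIso_transitive[OF ordIso_transitive[OF q(1) a(2)]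
            ordIso_symmetric[OF T]] by blast
      then have "r =o g (Some a)"
        by (simp add: g_def)
      then show ?thesis
        using a(1) by (auto simp: Field_ord_succ)
    qed
  qed
  ultimately show ?thesis
    unfolding is_aleph_def using cs by (intro conjI exI[of _ g]) simp_all
qed

text \<open>
  Below, a linear order \<open>r\<close> on \<open>X\<close> is a reflexive relation, so that \<open>x < y\<close> reads
  \<open>(x, y) \<in> r - Id\<close>.
\<close>

definition interval :: "'a rel \<Rightarrow> 'a set \<Rightarrow> 'a \<Rightarrow> 'a \<Rightarrow> 'a set" where
  "interval r X y1 y2 = {x \<in> X. (y1, x) \<in> r - Id \<and> (x, y2) \<in> r - Id}"

definition full_right :: "'d rel \<Rightarrow> 'a rel \<Rightarrow> 'a set \<Rightarrow> 'a set \<Rightarrow> bool" where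
  "full_right l r X Y \<longleftrightarrow>
     (\<forall>y\<in>Y. |\<Union>y'\<in>{y'\<in>Y. (y, y') \<in> r - Id}. interval r X y y'| =o l)"

definition full_left :: "'d rel \<Rightarrow> 'a rel \<Rightarrow> 'a set \<Rightarrow> 'a set \<Rightarrow> bool" where
  "full_left l r X Y \<longleftrightarrow>
     (\<forall>y\<in>Y. |\<Union>y'\<in>{y'\<in>Y. (y', y) \<in> r - Id}. interval r X y' y| =o l)"

definition full_in :: "'d rel \<Rightarrow> 'a rel \<Rightarrow> 'a set \<Rightarrow> 'a set \<Rightarrow> bool" where
  "full_in l r X Y \<longleftrightarrow> full_right l r X Y \<or> full_left l r X Y"

end

theory Submission
  imports Defs
begin

text \<open>
  Starting from \<open>X\<close>, split every cell of size \<open>\<lambda>\<close> at a point that has \<open>\<lambda>\<close> points of the cell on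
  either side, taking intersections at limit stages. There are at most \<open>2\<^bsup>\<kappa>\<^esup> < \<lambda>\<close> cells
  at levels below \<open>\<kappa>\<^sup>+\<close>, so by regularity fewer than \<open>\<lambda>\<close> points are splitting points or ever
  fall into a cell of size \<open>< \<lambda>\<close>. A remaining point \<open>x\<close> meets \<open>\<kappa>\<^sup>+\<close> splitting points, \<open>\<kappa>\<^sup>+\<close> of
  which lie on the same side of \<open>x\<close>; these form a monotone sequence, and any two of them are
  separated by one of the two halves of the cell of the later one, which has size \<open>\<lambda>\<close>.
\<close>

text \<open>A proper initial segment of \<open>Restr C U\<close> lies inside some
  \<open>underS C a\<close>, so its field is too small for it to reach length \<open>C\<close>;
  hence the restriction is no longer than \<open>C\<close>. It is no shorter because
  \<open>|U|\<close> is the least well-order on \<open>U\<close>.\<close>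

lemma Restr_ordIso_Card_order:
  assumes C: "Card_order C" and U: "U \<subseteq> Field C" and card: "|U| =o C"
  shows "Restr C U =o C"
proof -
  have wo: "Well_order C" and woU: "well_order_on U (Restr C U)"
    using C U well_order_on_Restr[of C U] by (auto simp: card_order_on_def)
  have F: "Field (Restr C U) = U"
    using well_order_on_Field[OF woU] by simp
  have woU': "Well_order (Restr C U)"
    using woU F by simp
  have "Restr (Restr C U) (underS (Restr C U) a) <o C" if "a \<in> U" for a
  proof (rule ccontr)
    let ?W = "Restr (Restr C U) (underS (Restr C U) a)"
    assume "\<not> ?W <o C"
    moreover have "Well_order ?W"
      using woU' by (rule Well_order_Restr)
    ultimately have "C \<le>o ?W"
      using wo not_ordLess_iff_ordLeq by blast
    then have "|Field C| \<le>o |Field ?W|"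
      by (rule card_of_mono2)
    also have "|Field ?W| \<le>o |underS C a|"
      by (rule card_of_mono1) (auto simp: Field_def underS_def)
    also have "|underS C a| <o C"
      using that U C by (blast intro: card_of_underS)
    also have "C =o |Field C|"
      using C by (rule ordIso_symmetric[OF card_of_Field_ordIso])
    finally show False
      using ordLess_irreflexive by blast
  qed
  then have "Restr C U \<le>o C"
    using ordLeq_iff_ordLess_Restr[OF woU' wo] F by blast
  moreover have "C \<le>o Restr C U"
    using ordIso_ordLeq_trans[OF ordIso_symmetric[OF card] card_of_least[OF woU]] .
  ultimately show ?thesis
    by (simp add: ordIso_iff_ordLeq)
qed

lemma card_of_finite_ordLess:
  assumes "Card_order l" "infinite (Field l)" "finite A"
  shows "|A| <o l"
  using assms finite_ordLess_infinite[of "|A|" l] card_of_Well_order[of A]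
    card_order_on_well_order_on[of "Field l" l] by (simp add: Field_card_of)

lemma card_of_Pow_mono:
  assumes "|A| \<le>o |B|"
  shows "|Pow A| \<le>o |Pow B|"
proof -
  obtain f where "inj_on f A" "f ` A \<subseteq> B"
    using assms card_of_ordLeq[of A B] by blast
  then show ?thesis
    using card_of_ordLeq[of "Pow A" "Pow B"] inj_on_image_Pow[of f A] image_Pow_mono[of f A B]
    by blast
qed

text \<open>Turns a decreasing sequence into an increasing one for the reversed order, so that
  \<open>full_right_chain\<close> covers both cases.\<close>

lemma full_right_converse: "full_right l (r\<inverse>) X Y \<longleftrightarrow> full_left l r X Y"
proof -
  have "interval (r\<inverse>) X a = (\<lambda>b. interval r X b a)" for a
    by (auto simp: interval_def)
  moreover have "(a, b) \<in> r\<inverse> - Id \<longleftrightarrow> (b, a) \<in> r - Id" for a b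
    by auto
  ultimately show ?thesis
    unfolding full_right_def full_left_def by (simp only:)
qed

text \<open>As \<open>|U| =o C\<close>, no index in \<open>U\<close> is the last one, so a single
  interval from \<open>q i\<close> to a later \<open>q j\<close> already has size \<open>l\<close>.
  Since \<open>q\<close> carries \<open>Restr C U\<close> isomorphically onto its image, the order
  type comes from \<open>Restr_ordIso_Card_order\<close>.\<close>

lemma full_right_chain:
  assumes r: "linear_order_on X r" and X: "|X| =o l"
    and C: "Card_order C" "infinite (Field C)" and U: "U \<subseteq> Field C" "|U| =o C"
    and q: "\<And>i. i \<in> U \<Longrightarrow> q i \<in> X"
    and mono: "\<And>i j. i \<in> U \<Longrightarrow> j \<in> U \<Longrightarrow> (i, j) \<in> C - Id \<Longrightarrow> (q i, q j) \<in> r - Id"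
    and large: "\<And>i j. i \<in> U \<Longrightarrow> j \<in> U \<Longrightarrow> (i, j) \<in> C - Id \<Longrightarrow> |interval r X (q i) (q j)| =o l"
  shows "full_right l r X (q ` U)" and "Restr r (q ` U) =o C"
proof -
  have wo: "Well_order C" and tot: "total_on (Field C) C" and refl: "\<And>i. i \<in> Field C \<Longrightarrow> (i, i) \<in> C"
    using C(1) by (auto simp: card_order_on_def well_order_on_def linear_order_on_def
        partial_order_on_def preorder_on_def refl_on_def)
  have antiC: "antisym C"
    using wo by (auto simp: well_order_on_def linear_order_on_def partial_order_on_def)
  have anti: "antisym r" and reflX: "\<And>x. x \<in> X \<Longrightarrow> (x, x) \<in> r"
    using r by (auto simp: linear_order_on_def partial_order_on_def preorder_on_def refl_on_def)
  have cases: "i = j \<or> (i, j) \<in> C - Id \<or> (j, i) \<in> C - Id" if "i \<in> U" "j \<in> U" for i j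
    using that U(1) tot by (auto simp: total_on_def)
  show "full_right l r X (q ` U)"
    unfolding full_right_def
  proof clarify
    fix i assume i: "i \<in> U"
    \<comment> \<open>A last index \<open>i\<close> would confine \<open>U\<close> to
      \<open>i\<close> and its predecessors, which are fewer than \<open>C\<close>.\<close>
    have "\<not> U \<subseteq> insert i (underS C i)"
    proof
      assume sub: "U \<subseteq> insert i (underS C i)"
      have "|insert i (underS C i)| <o C"
      proof -
        have "|{i}| <o C"
          using C by (intro card_of_finite_ordLess) auto
        moreover have "|underS C i| <o C"
          using i U(1) C(1) by (blast intro: card_of_underS)
        ultimately show ?thesis
          using card_of_Un_ordLess_infinite_Field[OF C(2,1), of "{i}" "underS C i"] by simp
      qed
      then have "|U| <o C"
        using card_of_mono1[OF sub] ordLeq_ordLess_trans by blast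
      then show False
        using U(2) not_ordLess_ordIso by blast
    qed
    then obtain j where j: "j \<in> U" "(i, j) \<in> C - Id"
      using cases[OF i] unfolding underS_def by blast
    let ?I = "\<Union>y'\<in>{y' \<in> q ` U. (q i, y') \<in> r - Id}. interval r X (q i) y'"
    have "|interval r X (q i) (q j)| \<le>o |?I|"
      using mono[OF i j] j(1) by (intro card_of_mono1) blast
    then have "l \<le>o |?I|"
      using large[OF i j] ordIso_ordLeq_trans ordIso_symmetric by blast
    moreover have "|?I| \<le>o |X|"
      by (rule card_of_mono1) (auto simp: interval_def)
    then have "|?I| \<le>o l"
      using X ordLeq_ordIso_trans by blast
    ultimately show "|?I| =o l"
      by (simp add: ordIso_iff_ordLeq)
  qed
  have inj: "inj_on q U"
    using cases mono by (fastforce simp: inj_on_def)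
  have F: "Field (Restr C U) = U"
    using Refl_Field_Restr2[of C U] U(1) wo
    by (simp add: well_order_on_def linear_order_on_def partial_order_on_def preorder_on_def)
  have "(i, j) \<in> C \<longleftrightarrow> (q i, q j) \<in> r" if "i \<in> U" "j \<in> U" for i j
  proof -
    consider "i = j" | "(i, j) \<in> C - Id" | "(j, i) \<in> C - Id"
      using cases[OF \<open>i \<in> U\<close> \<open>j \<in> U\<close>] by blast
    then show ?thesis
    proof cases
      case 1
      then show ?thesis
        using refl[of i] U(1) reflX[OF q[of i]] that by blast
    next
      case 2
      then show ?thesis
        using mono[of i j] that by blast
    next
      case 3
      then show ?thesis
        using mono[of j i] that antisymD[OF anti] antisymD[OF antiC] by blast
    qed
  qed
  then have "Restr r (q ` U) = dir_image (Restr C U) q"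
    by (auto simp: dir_image_def)
  also have "dir_image (Restr C U) q =o Restr C U"
    using dir_image_ordIso[OF Well_order_Restr[OF wo], of q U] inj F
    by (simp add: ordIso_symmetric)
  also have "Restr C U =o C"
    by (rule Restr_ordIso_Card_order[OF C(1) U])
  finally show "Restr r (q ` U) =o C" .
qed

text \<open>Here \<open>p\<close> picks the splitting point of a cell and \<open>S i\<close> is the
  cell of \<open>x\<close> at level \<open>i\<close>. A point whose branch breaks off is classified
  by the first level where this happens and by its sides at the earlier levels. Each class has fewer
  than \<open>l\<close> points and there are fewer than \<open>l\<close> classes, so regularity
  leaves a point with an unbroken branch.\<close>

lemma long_branch:
  assumes l: "Cinfinite l" "regularCard l" and X: "|X| =o l"
    and C: "Well_order C" "|Field C| <o l"
      "\<And>i. i \<in> Field C \<Longrightarrow> |Pow (underS C i)| <o l"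
  shows "\<exists>x S. (\<forall>i\<in>Field C. S i \<subseteq> X \<and> |S i| =o l) \<and>
    (\<forall>i. \<forall>j\<in>underS C i. \<forall>z\<in>S i.
      z \<noteq> p (S j) \<and> ((z, p (S j)) \<in> r \<longleftrightarrow> (x, p (S j)) \<in> r))"
proof -
  have wf: "wf (C - Id)"
    using C(1) by (simp add: well_order_on_def)
  define S where "S x = wfrec (C - Id) (\<lambda>f i. {z \<in> X. \<forall>j\<in>underS C i.
      z \<noteq> p (f j) \<and> ((z, p (f j)) \<in> r \<longleftrightarrow> (x, p (f j)) \<in> r)})" for x
  have S: "S x i = {z \<in> X. \<forall>j\<in>underS C i.
      z \<noteq> p (S x j) \<and> ((z, p (S x j)) \<in> r \<longleftrightarrow> (x, p (S x j)) \<in> r)}" for x i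
  proof -
    have "cut (S x) (C - Id) i j = S x j" if "j \<in> underS C i" for j
      using that by (simp add: cut_apply underS_def)
    then show ?thesis
      unfolding S_def by (subst wfrec[OF wf]) (simp flip: S_def)
  qed
  \<comment> \<open>The path of \<open>x\<close>: the earlier levels where it is at or below the
    splitting point. By \<open>S_eq\<close> the path determines the cell, so the cells at level
    \<open>i\<close> are counted by subsets of \<open>underS C i\<close>.\<close>
  define A where "A x i = {j \<in> underS C i. (x, p (S x j)) \<in> r}" for x i
  have trans: "trans C" and antiC: "antisym C"
    using C(1) by (auto simp: well_order_on_def linear_order_on_def partial_order_on_def
        preorder_on_def)
  have S_eq: "S x i = S y i" if "A x i = A y i" for x y i
    using that
  proof (induction i rule: wf_induct_rule[OF wf])
    case (1 i)
    have *: "S x j = S y j" if j: "j \<in> underS C i" for j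
    proof (rule 1(1))
      show "(j, i) \<in> C - Id"
        using j by (auto simp: underS_def)
      have "underS C j \<subseteq> underS C i"
        using j trans antiC by (auto simp: underS_def dest: transD antisymD)
      \<comment> \<open>Paths restrict to earlier levels, so equal paths at \<open>i\<close> are
        equal at \<open>j\<close> and the induction hypothesis applies.\<close>
      then have "A z j = A z i \<inter> underS C j" for z
        by (auto simp: A_def)
      then show "A x j = A y j"
        using 1(2) by simp
    qed
    have "((x, p (S x j)) \<in> r) = ((y, p (S y j)) \<in> r)" if "j \<in> underS C i" for j
      using 1(2) that by (auto simp: A_def)
    then show ?case
      using * by (subst (1 2) S) auto
  qed
  define bad where "bad x i \<longleftrightarrow> i \<in> Field C \<and> (\<not> |S x i| =o l \<or> x = p (S x i))" for x i
  \<comment> \<open>Points grouped by first failing level and path up to it; the points of one group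
    share a cell and still lie in it.\<close>
  define B where "B i D = {x \<in> X. bad x i \<and> (\<forall>j\<in>underS C i. \<not> bad x j) \<and> A x i = D}" for i D
  have "|B i D| <o l" for i D
  proof (cases "B i D = {}")
    case True
    then show ?thesis
      using l(1) by (auto simp: cinfinite_def intro: card_of_finite_ordLess)
  next
    case False
    then obtain y where y: "y \<in> B i D"
      by blast
    have sub: "S y i \<subseteq> X"
      by (subst S) auto
    have eq: "S x i = S y i" if "x \<in> B i D" for x
      using S_eq[of x i y] that y by (auto simp: B_def)
    have cell: "x \<in> S x i" if "x \<in> B i D" for x
      using that by (subst S) (auto simp: B_def bad_def underS_def Field_def)
    show ?thesis
    \<comment> \<open>In a large common cell, failing means being its splitting point; otherwise the
      group lies in a cell smaller than \<open>l\<close>.\<close>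
    proof (cases "|S y i| =o l")
      case True
      have "x = p (S y i)" if "x \<in> B i D" for x
        using True eq[OF that] that by (simp add: B_def bad_def)
      then have "B i D \<subseteq> {p (S y i)}"
        by blast
      then have "finite (B i D)"
        by (rule finite_subset) simp
      then show ?thesis
        using l(1) by (auto simp: cinfinite_def intro: card_of_finite_ordLess)
    next
      case False
      have "|S y i| \<le>o l"
        using card_of_mono1[OF sub] X ordLeq_ordIso_trans by blast
      then have "|S y i| <o l"
        using False ordLeq_iff_ordLess_or_ordIso by blast
      moreover have "B i D \<subseteq> S y i"
        using eq cell by auto
      ultimately show ?thesis
        using card_of_mono1 ordLeq_ordLess_trans by blast
    qed
  qed
  \<comment> \<open>Regularity is used twice: over the paths at one level, then over the
    levels.\<close>
  then have "|\<Union>i\<in>Field C. \<Union>D\<in>Pow (underS C i). B i D| <o l"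
    using l C by (intro regularCard_UNION_bound) auto
  moreover have "{x \<in> X. \<exists>i. bad x i} \<subseteq> (\<Union>i\<in>Field C. \<Union>D\<in>Pow (underS C i). B i D)"
  proof clarify
    fix x i0 assume x: "x \<in> X" "bad x i0"
    then obtain i where i: "bad x i" "\<And>j. (j, i) \<in> C - Id \<Longrightarrow> \<not> bad x j"
      using wfE_min[OF wf, of i0 "Collect (bad x)"] by auto
    then have "x \<in> B i (A x i)"
      using x by (auto simp: B_def underS_def)
    moreover have "i \<in> Field C" "A x i \<in> Pow (underS C i)"
      using i by (auto simp: bad_def A_def)
    ultimately show "x \<in> (\<Union>i\<in>Field C. \<Union>D\<in>Pow (underS C i). B i D)"
      by blast
  qed
  ultimately have "|{x \<in> X. \<exists>i. bad x i}| <o l"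
    using card_of_mono1 ordLeq_ordLess_trans by blast
  then have "{x \<in> X. \<exists>i. bad x i} \<noteq> X"
    using X not_ordLess_ordIso by metis
  then obtain x where x: "\<And>i. \<not> bad x i"
    by blast
  have "S x i \<subseteq> X \<and> |S x i| =o l" if "i \<in> Field C" for i
    using x[of i] that S[of x i] by (auto simp: bad_def)
  moreover have "z \<noteq> p (S x j) \<and> ((z, p (S x j)) \<in> r \<longleftrightarrow> (x, p (S x j)) \<in> r)"
    if "j \<in> underS C i" "z \<in> S x i" for i j z
    using that S[of x i] by auto
  ultimately show ?thesis
    by (intro exI[of _ x] exI[of _ "S x"]) auto
qed

theorem theorem3p2:
  fixes \<alpha> :: "'b rel" and \<kappa> :: "'c rel" and l :: "'d rel"
    and X :: "'a set" and r :: "'a rel"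
  assumes "Well_order \<alpha>"
    and "is_aleph \<alpha> \<kappa>"
    and "Card_order l" and "regularCard l"
    and "ctwo ^c \<kappa> <o l"
    and "linear_order_on X r"
    and "|X| =o l"
    and "\<forall>Y\<subseteq>X. |Y| =o l \<longrightarrow>
           (\<exists>y\<in>Y. |{z\<in>Y. (z, y) \<in> r - Id}| =o l \<and> |{z\<in>Y. (y, z) \<in> r - Id}| =o l)"
  shows "\<exists>Y\<subseteq>X. full_in l r X Y \<and>
           (Restr r Y =o cardSuc \<kappa> \<or> (Restr r Y)\<inverse> =o cardSuc \<kappa>)"
proof -
  define C where "C = cardSuc \<kappa>"
  have \<kappa>: "Card_order \<kappa>" "infinite (Field \<kappa>)"
    using assms(2) by (auto simp: is_aleph_def)
  have C: "Card_order C" "infinite (Field C)" "Well_order C"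
    using \<kappa> cardSuc_Card_order cardSuc_finite unfolding C_def card_order_on_def by blast+
  have "\<kappa> <o ctwo ^c \<kappa>"
    using \<kappa>(1) by (rule ordLess_ctwo_cexp)
  then have "C \<le>o ctwo ^c \<kappa>"
    unfolding C_def using \<kappa>(1) by (intro cardSuc_least) (auto simp: Card_order_cexp)
  then have "C <o l"
    using assms(5) ordLeq_ordLess_trans by blast
  then have C_l: "|Field C| <o l"
    using C(1) card_of_Field_ordIso ordIso_ordLess_trans by blast
  \<comment> \<open>A level below the successor of \<open>\<kappa>\<close> has at most
    \<open>\<kappa>\<close> predecessors, hence at most \<open>ctwo ^c \<kappa>\<close> paths lead
    to it.\<close>
  have Pow: "|Pow (underS C i)| <o l" if "i \<in> Field C" for i
  proof -
    have "|underS C i| <o cardSuc \<kappa>"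
      using card_of_underS[OF C(1) that] by (simp add: C_def)
    then have "|underS C i| \<le>o \<kappa>"
      using \<kappa>(1) by (simp add: cardSuc_ordLeq_ordLess card_of_Card_order)
    then have "|underS C i| \<le>o |Field \<kappa>|"
      using \<kappa>(1) card_of_Field_ordIso ordIso_symmetric ordLeq_ordIso_trans by blast
    then have "|Pow (underS C i)| \<le>o |Pow (Field \<kappa>)|"
      by (rule card_of_Pow_mono)
    also have "|Pow (Field \<kappa>)| =o ctwo ^c \<kappa>"
      unfolding ctwo_def cexp_def Field_card_of by (rule card_of_Pow_Func)
    finally show ?thesis
      using assms(5) ordLeq_ordLess_trans by blast
  qed
  have "|Field C| \<le>o |Field l|"
    using \<open>C <o l\<close> card_of_mono2 ordLess_imp_ordLeq by blast
  then have l: "Cinfinite l"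
    using C(2) assms(3) card_of_ordLeq_infinite by (auto simp: cinfinite_def)
  have tot: "total_on X r"
    using assms(6) by (simp add: linear_order_on_def)
  \<comment> \<open>With the implication inside the existential, \<open>choice\<close> yields a
    total \<open>p\<close>, arbitrary on sets that are not of size \<open>l\<close>.\<close>
  have "\<forall>Y. \<exists>y. Y \<subseteq> X \<and> |Y| =o l \<longrightarrow> y \<in> Y \<and>
      |{z \<in> Y. (z, y) \<in> r - Id}| =o l \<and> |{z \<in> Y. (y, z) \<in> r - Id}| =o l"
    using assms(8) by blast
  from choice[OF this] obtain p where p: "\<And>Y. Y \<subseteq> X \<Longrightarrow> |Y| =o l \<Longrightarrow> p Y \<in> Y \<and>
      |{z \<in> Y. (z, p Y) \<in> r - Id}| =o l \<and> |{z \<in> Y. (p Y, z) \<in> r - Id}| =o l"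
    by blast
  have "\<exists>x S. (\<forall>i\<in>Field C. S i \<subseteq> X \<and> |S i| =o l) \<and>
    (\<forall>i. \<forall>j\<in>underS C i. \<forall>z\<in>S i.
      z \<noteq> p (S j) \<and> ((z, p (S j)) \<in> r \<longleftrightarrow> (x, p (S j)) \<in> r))"
    by (rule long_branch[OF l assms(4,7) C(3) C_l Pow])
  then obtain x S where S': "\<forall>i\<in>Field C. S i \<subseteq> X \<and> |S i| =o l"
    and side': "\<forall>i. \<forall>j\<in>underS C i. \<forall>z\<in>S i.
      z \<noteq> p (S j) \<and> ((z, p (S j)) \<in> r \<longleftrightarrow> (x, p (S j)) \<in> r)"
    by (elim exE conjE)
  note S = S'[rule_format] and side = side'[rule_format]
  define q where "q i = p (S i)" for i
  have q: "q i \<in> S i" "q i \<in> X" "|{z \<in> S i. (z, q i) \<in> r - Id}| =o l"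
    "|{z \<in> S i. (q i, z) \<in> r - Id}| =o l" if "i \<in> Field C" for i
    using S[OF that] p[of "S i"] unfolding q_def by blast+
  have sandwich: "|I| =o l" if "A \<subseteq> I" "I \<subseteq> X" "|A| =o l" for A I
    using ordLeq_ordIso_trans[OF card_of_mono1[OF that(2)] assms(7)]
      ordIso_ordLeq_trans[OF ordIso_symmetric[OF that(3)] card_of_mono1[OF that(1)]]
    by (simp add: ordIso_iff_ordLeq)
  \<comment> \<open>The levels are sorted by the side of \<open>x\<close>: after a level in
    \<open>D\<close> all later cells lie below \<open>q i\<close>, after one in \<open>U\<close>
    above it. So \<open>q\<close> decreases along \<open>D\<close> and increases along
    \<open>U\<close>.\<close>
  define D where "D = {i \<in> Field C. (x, q i) \<in> r}"
  define U where "U = {i \<in> Field C. (x, q i) \<notin> r}"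
  have D: "(z, q i) \<in> r - Id" if "i \<in> D" "(i, j) \<in> C - Id" "z \<in> S j" for i j z
    using side[of i j z] that by (auto simp: D_def q_def underS_def)
  have U: "(q i, z) \<in> r - Id" if "i \<in> U" "(i, j) \<in> C - Id" "z \<in> S j" for i j z
  proof -
    have "z \<in> X" "q i \<in> X"
      using that S[of j] q(2)[of i] by (auto simp: U_def Field_def)
    then show ?thesis
      using side[of i j z] that tot by (auto simp: U_def q_def underS_def total_on_def)
  qed
  have UC: "U \<subseteq> Field C" and DC: "D \<subseteq> Field C"
    by (auto simp: U_def D_def)
  have le: "|E| \<le>o C" if "E \<subseteq> Field C" for E
    by (rule ordLeq_ordIso_trans[OF card_of_mono1[OF that] card_of_Field_ordIso[OF C(1)]])
  have "\<not> ( |U| <o C \<and> |D| <o C)"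
  proof
    assume "|U| <o C \<and> |D| <o C"
    then have "|U \<union> D| <o C"
      using card_of_Un_ordLess_infinite_Field[OF C(2,1)] by blast
    moreover have "U \<union> D = Field C"
      by (auto simp: U_def D_def)
    ultimately show False
      using card_of_Field_ordIso[OF C(1)] not_ordLess_ordIso by metis
  qed
  then consider "|U| =o C" | "|D| =o C"
    using le[OF UC] le[OF DC] by (auto simp: ordLeq_iff_ordLess_or_ordIso)
  then show ?thesis
  proof cases
    case 1
    have "|interval r X (q i) (q j)| =o l" if "i \<in> U" "j \<in> U" "(i, j) \<in> C - Id" for i j
    proof (rule sandwich)
      have j: "j \<in> Field C"
        using that(2) UC by blast
      \<comment> \<open>All of \<open>S j\<close> lies above \<open>q i\<close>, so the part of it
        below \<open>q j\<close> fits between the two points; it has size \<open>l\<close> by the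
        choice of \<open>q j\<close>.\<close>
      show "{z \<in> S j. (z, q j) \<in> r - Id} \<subseteq> interval r X (q i) (q j)"
        using U[OF that(1,3)] S[OF j] by (auto simp: interval_def)
      show "interval r X (q i) (q j) \<subseteq> X"
        by (auto simp: interval_def)
      show "|{z \<in> S j. (z, q j) \<in> r - Id}| =o l"
        by (rule q(3)[OF j])
    qed
    moreover have "(q i, q j) \<in> r - Id" if "i \<in> U" "j \<in> U" "(i, j) \<in> C - Id" for i j
      using U[OF that(1,3) q(1)] that(2) UC by blast
    ultimately have "full_right l r X (q ` U)" "Restr r (q ` U) =o C"
      using full_right_chain[OF assms(6,7) C(1,2) UC 1, of q] q(2) UC by blast+
    then show ?thesis
      using q(2) UC by (intro exI[of _ "q ` U"]) (auto simp: full_in_def C_def)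
  next
    case 2
    have "|interval (r\<inverse>) X (q i) (q j)| =o l" if "i \<in> D" "j \<in> D" "(i, j) \<in> C - Id" for i j
    proof (rule sandwich)
      have j: "j \<in> Field C"
        using that(2) DC by blast
      \<comment> \<open>Mirror image: \<open>S j\<close> lies below \<open>q i\<close>, so now its
        part above \<open>q j\<close> fills the interval.\<close>
      show "{z \<in> S j. (q j, z) \<in> r - Id} \<subseteq> interval (r\<inverse>) X (q i) (q j)"
        using D[OF that(1,3)] S[OF j] by (auto simp: interval_def)
      show "interval (r\<inverse>) X (q i) (q j) \<subseteq> X"
        by (auto simp: interval_def)
      show "|{z \<in> S j. (q j, z) \<in> r - Id}| =o l"
        by (rule q(4)[OF j])
    qed
    moreover have "(q i, q j) \<in> r\<inverse> - Id" if "i \<in> D" "j \<in> D" "(i, j) \<in> C - Id" for i j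
      using D[OF that(1,3) q(1)] that(2) DC by auto
    moreover have "linear_order_on X (r\<inverse>)"
      using assms(6) by simp
    ultimately have "full_right l (r\<inverse>) X (q ` D)" "Restr (r\<inverse>) (q ` D) =o C"
      using full_right_chain[OF _ assms(7) C(1,2) DC 2, of "r\<inverse>" q] q(2) DC by blast+
    moreover have "Restr (r\<inverse>) (q ` D) = (Restr r (q ` D))\<inverse>"
      by auto
    ultimately show ?thesis
      using q(2) DC
      by (intro exI[of _ "q ` D"]) (auto simp: full_in_def full_right_converse C_def)
  qed
qed

end
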